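(* Let $A\in\mathbb{R}^{n\times n}$, $b\in\mathbb{R}^n$ and $0\le\theta<1$. Assume that $A-D(x)$ is invertible for all $x\in\mathbb{R}^n$. Then the inexact semi-smooth Newton sequence $\{x_k\}$, given by $$\big\|[A-D(x_k)]x_{k+1}-b\big\|\le\theta\,\|F(x_k)\|,\qquad k=0,1,\ldots,$$ with any starting point $x_0\in\mathbb{R}^n$ and residual relative error tolerance $\theta$, is well defined. Moreover, if $$\big\|[A-D(x)]^{-1}\big\|<\tfrac12\qquad\text{for all }x\in\mathbb{R}^n,$$ then the equation $Ax-|x|=b$ has a unique solution. Additionally, if $$0\le\theta<\frac{1-2\,\|[A-D(x)]^{-1}\|}{\|[A-D(x)]^{-1}\|\,\big(\|A-D(x)\|+2\big)}\qquad\text{for all }x\in\mathbb{R}^n,$$ then $\{x_k\}$ converges $Q$-linearly to $x_*\in\mathbb{R}^n$, a unique solution of $Ax-|x|=b$, as follows: $$\|x_{k+1}-x_*\|\le\big\|[A-D(x_k)]^{-1}\big\|\,\big[\theta\,(\|A-D(x_k)\|+2)+2\big]\,\|x_k-x_*\|,\qquad\text{for all }k=0,1,\ldots.$$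
   Context: For $x\in\mathbb{R}^n$, $|x|$ is the vector with components $|x_i|$; $\operatorname{sgn}(x)$ is the vector with components $-1,0,1$ according to whether $x_i$ is negative, zero or positive; and $D(x):=\operatorname{diag}(\operatorname{sgn}(x))$ is the diagonal matrix with diagonal $\operatorname{sgn}(x)$. The function $F:\mathbb{R}^n\to\mathbb{R}^n$ is $F(x):=Ax-|x|-b$. $\|\cdot\|$ is a norm on $\mathbb{R}^n$, and for matrices $M\in\mathbb{R}^{n\times n}$, $\|M\|:=\max\{\|Mx\|: x\in\mathbb{R}^n,\ \|x\|=1\}$. The inexact semi-smooth Newton sequence is any sequence whose iterates satisfy the displayed residual inequality; it is well defined if at every iterate $x_k$ there exists a point $x_{k+1}$ satisfying this inequality. A sequence $\{x_k\}$ converges $Q$-linearly to $x_*$ if it converges to $x_*$ and there is a constant $c\in[0,1)$ with $\|x_{k+1}-x_*\|\le c\|x_k-x_*\|$ for all sufficiently large $k$.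
   Formalization: For the second and third claims (unique solution, Q-linear convergence and error bound) the norm is additionally assumed to be absolute, i.e. ‖ |x| ‖ = ‖x‖ for all x; for arbitrary norms these claims are false. *)

theory Defs
  imports "HOL-Analysis.Analysis"
begin

(* The library fixes the Euclidean norm on real ^ 'n, so other norms are passed explicitly. *)
definition is_norm :: "(real ^ 'n \<Rightarrow> real) \<Rightarrow> bool" where
  "is_norm N \<longleftrightarrow>
     (\<forall>x. 0 \<le> N x) \<and> (\<forall>x. N x = 0 \<longleftrightarrow> x = 0) \<and>
     (\<forall>c x. N (c *\<^sub>R x) = \<bar>c\<bar> * N x) \<and> (\<forall>x y. N (x + y) \<le> N x + N y)"

(* On vectors the bars are the componentwise absolute value of Ordered_Euclidean_Space.
   Absoluteness is what makes N monotone in the absolute values of the components and hence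
   N (\<bar>x\<bar> - \<bar>y\<bar>) \<le> N (x - y), which fails for general norms. *)
definition absolute_norm :: "(real ^ 'n \<Rightarrow> real) \<Rightarrow> bool" where
  "absolute_norm N \<longleftrightarrow> is_norm N \<and> (\<forall>x. N \<bar>x\<bar> = N x)"

(* GREATEST is the maximum; mat_norm_attained and mat_norm_upper show that it exists. *)
definition mat_norm :: "(real ^ 'n \<Rightarrow> real) \<Rightarrow> real ^ 'n ^ 'n \<Rightarrow> real" where
  "mat_norm N M = (GREATEST r. \<exists>x. N x = 1 \<and> r = N (M *v x))"

(* The library constant sgn on real ^ 'n is x /\<^sub>R norm x, hence the componentwise version. *)
definition sgn_vec :: "real ^ 'n \<Rightarrow> real ^ 'n" where
  "sgn_vec x = (\<chi> i. sgn (x $ i))"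

definition diag :: "real ^ 'n \<Rightarrow> real ^ 'n ^ 'n" where
  "diag v = (\<chi> i j. if i = j then v $ i else 0)"

definition sgn_diag :: "real ^ 'n \<Rightarrow> real ^ 'n ^ 'n" where
  "sgn_diag x = diag (sgn_vec x)"

definition ave_fun :: "real ^ 'n ^ 'n \<Rightarrow> real ^ 'n \<Rightarrow> real ^ 'n \<Rightarrow> real ^ 'n" where
  "ave_fun A b x = A *v x - \<bar>x\<bar> - b"

definition newton_step ::
  "(real ^ 'n \<Rightarrow> real) \<Rightarrow> real ^ 'n ^ 'n \<Rightarrow> real ^ 'n \<Rightarrow> real \<Rightarrow> real ^ 'n \<Rightarrow> real ^ 'n \<Rightarrow> bool" where
  "newton_step N A b \<theta> x y \<longleftrightarrow> N ((A - sgn_diag x) *v y - b) \<le> \<theta> * N (ave_fun A b x)"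

definition newton_sequence ::
  "(real ^ 'n \<Rightarrow> real) \<Rightarrow> real ^ 'n ^ 'n \<Rightarrow> real ^ 'n \<Rightarrow> real \<Rightarrow> (nat \<Rightarrow> real ^ 'n) \<Rightarrow> bool" where
  "newton_sequence N A b \<theta> X \<longleftrightarrow> (\<forall>k. newton_step N A b \<theta> (X k) (X (Suc k)))"

(* A step need not determine its successor, so the iterates form the set reachable from x0. *)
inductive newton_iterate ::
  "(real ^ 'n \<Rightarrow> real) \<Rightarrow> real ^ 'n ^ 'n \<Rightarrow> real ^ 'n \<Rightarrow> real \<Rightarrow> real ^ 'n \<Rightarrow> real ^ 'n \<Rightarrow> bool"
  for N A b \<theta> x0 where
  start: "newton_iterate N A b \<theta> x0 x0"
| step: "newton_iterate N A b \<theta> x0 x \<Longrightarrow> newton_step N A b \<theta> x y \<Longrightarrow> newton_iterate N A b \<theta> x0 y"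

definition newton_well_defined ::
  "(real ^ 'n \<Rightarrow> real) \<Rightarrow> real ^ 'n ^ 'n \<Rightarrow> real ^ 'n \<Rightarrow> real \<Rightarrow> real ^ 'n \<Rightarrow> bool" where
  "newton_well_defined N A b \<theta> x0 \<longleftrightarrow>
     (\<forall>x. newton_iterate N A b \<theta> x0 x \<longrightarrow> (\<exists>y. newton_step N A b \<theta> x y))"

definition Q_linearly_converges ::
  "(real ^ 'n \<Rightarrow> real) \<Rightarrow> (nat \<Rightarrow> real ^ 'n) \<Rightarrow> real ^ 'n \<Rightarrow> bool" where
  "Q_linearly_converges N X l \<longleftrightarrow>
     X \<longlonglongrightarrow> l \<and>
     (\<exists>c. 0 \<le> c \<and> c < 1 \<and> (\<forall>\<^sub>F k in sequentially. N (X (Suc k) - l) \<le> c * N (X k - l)))"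

lemma is_norm_convex: "is_norm N \<Longrightarrow> convex_on UNIV N"
  unfolding is_norm_def by (intro convex_onI) (auto, smt (verit) )

lemma is_norm_continuous: "is_norm N \<Longrightarrow> continuous_on S N"
  using convex_on_continuous[OF open_UNIV is_norm_convex] continuous_on_subset by blast

lemma is_norm_compact_sphere:
  assumes "is_norm N" shows "compact {x. N x = 1}"
proof -
  have cont: "continuous_on (sphere 0 1) N" by (rule is_norm_continuous[OF assms])
  have ne: "sphere (0::real^'n) 1 \<noteq> {}" by simp
  obtain m where m: "m \<in> sphere 0 1" "\<And>y. y \<in> sphere 0 1 \<Longrightarrow> N m \<le> N y"
    using continuous_attains_inf[OF compact_sphere ne cont] by blast
  have "m \<noteq> 0" using m(1) by auto
  then have mpos: "0 < N m" using assms unfolding is_norm_def by (metis less_eq_real_def)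
  have hom: "N (c *\<^sub>R x) = \<bar>c\<bar> * N x" for c x using assms by (simp add: is_norm_def)
  have bound: "norm x \<le> 1 / N m" if "N x = 1" for x
  proof -
    have "x \<noteq> 0" using that assms unfolding is_norm_def by (metis zero_neq_one)
    then have "N m \<le> N ((1 / norm x) *\<^sub>R x)" by (intro m(2)) simp
    also have "\<dots> = 1 / norm x" using hom[of "1 / norm x" x] that by simp
    finally show ?thesis using \<open>x \<noteq> 0\<close> mpos by (simp add: field_simps)
  qed
  have "bounded {x. N x = 1}" using bound by (auto simp: bounded_iff)
  moreover have "closed {x. N x = 1}"
    using continuous_closed_preimage_constant[OF is_norm_continuous[OF assms] closed_UNIV] by simp
  ultimately show ?thesis by (simp add: compact_eq_bounded_closed)
qed

lemma mat_norm_max: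
  assumes "is_norm N"
  obtains x where "N x = 1" "mat_norm N M = N (M *v x)" "\<And>y. N y = 1 \<Longrightarrow> N (M *v y) \<le> mat_norm N M"
proof -
  let ?e = "axis undefined 1 :: real ^ 'n"
  have e: "?e \<noteq> 0" by (simp add: axis_eq_0_iff)
  then have "N ((1 / N ?e) *\<^sub>R ?e) = 1"
    using assms unfolding is_norm_def by simp
  then have ne: "{x. N x = 1} \<noteq> {}" by blast
  have "continuous_on {x. N x = 1} (N \<circ> (\<lambda>x. M *v x))"
    by (intro continuous_on_compose is_norm_continuous[OF assms] matrix_vector_mult_linear_continuous_on)
  from continuous_attains_sup[OF is_norm_compact_sphere[OF assms] ne this]
  obtain x where x: "N x = 1" "\<And>y. N y = 1 \<Longrightarrow> N (M *v y) \<le> N (M *v x)" by auto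
  have "mat_norm N M = N (M *v x)"
    unfolding mat_norm_def by (rule Greatest_equality) (use x in auto)
  with x show ?thesis by (intro that) auto
qed

lemma mat_norm_attained: "is_norm N \<Longrightarrow> \<exists>x. N x = 1 \<and> mat_norm N M = N (M *v x)"
  using mat_norm_max by metis

lemma mat_norm_upper: "is_norm N \<Longrightarrow> N y = 1 \<Longrightarrow> N (M *v y) \<le> mat_norm N M"
  using mat_norm_max by metis

end

theory Submission
  imports Defs
begin

text \<open>
  Since \<open>sgn_diag x *v x = \<bar>x\<bar>\<close>, the linearisation error of the componentwise absolute value at
  \<open>x\<close> is at most \<open>2 * N (x - y)\<close> for an absolute norm, and every error estimate reduces to this
  one. The exact Newton map \<open>G x = matrix_inv (A - sgn_diag x) *v b\<close> has finite range, because there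
  are finitely many sign patterns, and it satisfies \<open>N (G (G x) - G x) < N (G x - x)\<close> unless
  \<open>G x = x\<close>. A point of the range with minimal \<open>N (G x - x)\<close> is thus a fixed point, and the fixed
  points are exactly the solutions. Finiteness of the set of sign patterns also makes the contraction
  factor uniform in \<open>x\<close>.
\<close>

section \<open>Norms and induced matrix norms\<close>

lemma is_norm_zero: "is_norm N \<Longrightarrow> N 0 = 0"
  by (simp add: is_norm_def)

lemma is_norm_nonneg: "is_norm N \<Longrightarrow> 0 \<le> N x"
  by (simp add: is_norm_def)

lemma is_norm_pos: "is_norm N \<Longrightarrow> x \<noteq> 0 \<Longrightarrow> 0 < N x"
  by (simp add: is_norm_def order_less_le)

lemma is_norm_scaleR: "is_norm N \<Longrightarrow> N (c *\<^sub>R x) = \<bar>c\<bar> * N x"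
  by (simp add: is_norm_def)

lemma is_norm_triangle: "is_norm N \<Longrightarrow> N (x + y) \<le> N x + N y"
  by (simp add: is_norm_def)

lemma is_norm_minus: "is_norm N \<Longrightarrow> N (- x) = N x"
  using is_norm_scaleR[of N "-1" x] by simp

lemma is_norm_triangle_diff: "is_norm N \<Longrightarrow> N (x - y) \<le> N x + N y"
  using is_norm_triangle[of N x "- y"] is_norm_minus[of N y] by simp

lemma is_norm_diff_commute: "is_norm N \<Longrightarrow> N (x - y) = N (y - x)"
  using is_norm_minus[of N "x - y"] by simp

lemma mat_norm_nonneg: "is_norm N \<Longrightarrow> 0 \<le> mat_norm N M"
  using mat_norm_attained[of N M] is_norm_nonneg[of N] by metis

text \<open>The maximum behind \<open>mat_norm\<close> ranges over unit vectors only; homogeneity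
  carries the bound over to every \<open>x\<close>.\<close>

lemma mat_norm_bound:
  assumes "is_norm N"
  shows "N (M *v x) \<le> mat_norm N M * N x"
proof (cases "x = 0")
  case True
  then show ?thesis by (simp add: is_norm_zero[OF assms])
next
  case False
  note pos = is_norm_pos[OF assms False]
  have "N ((1 / N x) *\<^sub>R x) = 1"
    using pos by (simp add: is_norm_scaleR[OF assms])
  then have "N (M *v ((1 / N x) *\<^sub>R x)) \<le> mat_norm N M"
    by (rule mat_norm_upper[OF assms])
  then show ?thesis
    using pos by (simp add: matrix_vector_mult_scaleR is_norm_scaleR[OF assms] field_simps)
qed

section \<open>Convergence measured in an arbitrary norm\<close>

lemma norm_le_is_norm:
  fixes N :: "real ^ 'n \<Rightarrow> real"
  assumes "is_norm N"
  obtains C where "\<And>x. norm x \<le> C * N x"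
proof -
  obtain C where C: "\<And>x. N x = 1 \<Longrightarrow> norm x \<le> C"
    using compact_imp_bounded[OF is_norm_compact_sphere[OF assms]] by (auto simp: bounded_iff)
  have "norm x \<le> C * N x" for x
  proof (cases "x = 0")
    case False
    note pos = is_norm_pos[OF assms False]
    have "norm ((1 / N x) *\<^sub>R x) \<le> C"
      using pos by (intro C) (simp add: is_norm_scaleR[OF assms])
    then show ?thesis using pos by (simp add: field_simps)
  qed (simp add: is_norm_zero[OF assms])
  then show ?thesis by (rule that)
qed

text \<open>The limit of \<open>X\<close> is Euclidean, while all estimates are in \<open>N\<close>;
  the constant \<open>C\<close> from the compact unit sphere of \<open>N\<close> translates between
  them.\<close>

lemma is_norm_tendsto:
  fixes X :: "nat \<Rightarrow> real ^ 'n"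
  assumes "is_norm N" and "(\<lambda>k. N (X k - l)) \<longlonglongrightarrow> 0"
  shows "X \<longlonglongrightarrow> l"
proof -
  obtain C where C: "\<And>x. norm x \<le> C * N x" by (rule norm_le_is_norm[OF assms(1)]) blast
  have "(\<lambda>k. C * N (X k - l)) \<longlonglongrightarrow> 0"
    using tendsto_mult_right_zero[OF assms(2)] by simp
  then have "(\<lambda>k. X k - l) \<longlonglongrightarrow> 0"
    by (rule Lim_null_comparison[OF always_eventually, rotated]) (use C in blast)
  then show ?thesis by (simp add: LIM_zero_iff)
qed

lemma Q_linearly_convergesI:
  assumes "is_norm N" and "0 \<le> c" "c < 1" and step: "\<And>k. N (X (Suc k) - l) \<le> c * N (X k - l)"
  shows "Q_linearly_converges N X l"
proof -
  have bound: "N (X k - l) \<le> c ^ k * N (X 0 - l)" for k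
  proof (induction k)
    case (Suc k)
    have "N (X (Suc k) - l) \<le> c * N (X k - l)" by (rule step)
    also have "\<dots> \<le> c * (c ^ k * N (X 0 - l))" using Suc assms(2) by (rule mult_left_mono)
    finally show ?case by simp
  qed simp
  have lim: "(\<lambda>k. c ^ k * N (X 0 - l)) \<longlonglongrightarrow> 0"
    using assms(2,3) by (intro tendsto_mult_left_zero LIMSEQ_realpow_zero)
  have "(\<lambda>k. N (X k - l)) \<longlonglongrightarrow> 0"
    by (rule tendsto_sandwich[OF _ _ tendsto_const lim])
      (use bound is_norm_nonneg[OF assms(1)] in auto)
  from is_norm_tendsto[OF assms(1) this] show ?thesis
    using assms(2-4) by (auto simp: Q_linearly_converges_def)
qed

section \<open>Monotonicity of absolute norms\<close>

lemma vec_abs_nth: "\<bar>x :: real ^ 'n\<bar> $ i = \<bar>x $ i\<bar>"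
  by (simp add: abs_vec_def)

lemma absolute_norm_cong:
  assumes "absolute_norm N" "\<And>i. \<bar>x $ i\<bar> = \<bar>y $ i\<bar>"
  shows "N x = N y"
proof -
  have "\<bar>x\<bar> = \<bar>y\<bar>" using assms(2) by (simp add: vec_eq_iff vec_abs_nth)
  then show ?thesis using assms(1) unfolding absolute_norm_def by metis
qed

text \<open>The modified vector is a convex combination of \<open>x\<close> and of \<open>x\<close> with its \<open>j\<close>-th sign flipped.\<close>

lemma absolute_norm_shrink_component:
  fixes x :: "real ^ 'n"
  assumes N: "absolute_norm N" and t: "\<bar>t\<bar> \<le> 1"
  shows "N (\<chi> i. if i = j then t * x $ i else x $ i) \<le> N x"
proof -
  have norm: "is_norm N" using N by (simp add: absolute_norm_def)
  define x' :: "real ^ 'n" where "x' = (\<chi> i. if i = j then - (x $ i) else x $ i)"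
  have flip: "N x' = N x" by (rule absolute_norm_cong[OF N]) (simp add: x'_def)
  have "(\<chi> i. if i = j then t * x $ i else x $ i) = ((1 + t) / 2) *\<^sub>R x + ((1 - t) / 2) *\<^sub>R x'"
    by (simp add: vec_eq_iff x'_def field_simps)
  then have "N (\<chi> i. if i = j then t * x $ i else x $ i) \<le> N (((1 + t) / 2) *\<^sub>R x) + N (((1 - t) / 2) *\<^sub>R x')"
    using is_norm_triangle[OF norm] by metis
  also have "\<dots> = N x" using t by (simp add: is_norm_scaleR[OF norm] flip field_simps)
  finally show ?thesis .
qed

text \<open>The components are shrunk one at a time, by induction on the set \<open>S\<close> of
  indices already treated.\<close>

lemma absolute_norm_contract:
  fixes x :: "real ^ 'n"
  assumes N: "absolute_norm N" and t: "\<And>i. \<bar>t i\<bar> \<le> 1"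
  shows "N (\<chi> i. t i * x $ i) \<le> N x"
proof -
  have "N (\<chi> i. if i \<in> S then t i * x $ i else x $ i) \<le> N x" if "finite S" for S
    using that
  proof (induction S)
    case (insert j S)
    let ?z = "\<chi> i. if i \<in> S then t i * x $ i else x $ i"
    have "(\<chi> i. if i \<in> insert j S then t i * x $ i else x $ i) =
        (\<chi> i. if i = j then t j * ?z $ i else ?z $ i)"
      using insert.hyps by (auto simp: vec_eq_iff)
    then show ?case
      using absolute_norm_shrink_component[OF N t[of j], of j ?z] insert.IH by simp
  qed simp
  from this[of UNIV] show ?thesis by simp
qed

lemma absolute_norm_mono:
  fixes x y :: "real ^ 'n"
  assumes N: "absolute_norm N" and le: "\<And>i. \<bar>x $ i\<bar> \<le> \<bar>y $ i\<bar>"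
  shows "N x \<le> N y"
proof -
  \<comment> \<open>The ratios have modulus at most 1. Where \<open>y $ i = 0\<close>, also
    \<open>x $ i = 0\<close>, so division by zero does no harm.\<close>
  have "(\<chi> i. (x $ i / y $ i) * y $ i) = x"
    using le by (auto simp: vec_eq_iff) (metis abs_le_zero_iff abs_zero)
  moreover have "N (\<chi> i. (x $ i / y $ i) * y $ i) \<le> N y"
    using le by (intro absolute_norm_contract[OF N]) (simp add: abs_div divide_le_eq_1)
  ultimately show ?thesis by simp
qed

section \<open>Sign matrices and the linearised absolute value\<close>

lemma sgn_diag_mult_nth: "(sgn_diag x *v y) $ i = sgn (x $ i) * y $ i"
  by (simp add: sgn_diag_def diag_def sgn_vec_def matrix_vector_mult_def if_distrib[of "\<lambda>a. a * _"]
      cong: if_cong)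

lemma sgn_diag_mult_self: "sgn_diag x *v x = \<bar>x\<bar>"
  by (simp add: vec_eq_iff sgn_diag_mult_nth vec_abs_nth abs_sgn mult.commute)

lemma finite_range_sgn_diag: "finite (range (sgn_diag :: real ^ 'n \<Rightarrow> _))"
proof -
  let ?V = "(\<lambda>f. \<chi> i. f i) ` (UNIV \<rightarrow>\<^sub>E {-1, 0, 1 :: real}) :: (real ^ 'n) set"
  have "sgn_vec x \<in> ?V" for x :: "real ^ 'n"
    by (rule image_eqI[where x = "\<lambda>i. sgn (x $ i)"]) (auto simp: sgn_vec_def sgn_real_def split: if_splits)
  then have "range (sgn_diag :: real ^ 'n \<Rightarrow> _) \<subseteq> diag ` ?V"
    by (auto simp: sgn_diag_def)
  moreover have "finite (diag ` ?V)" by (intro finite_imageI finite_PiE) auto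
  ultimately show ?thesis by (rule finite_subset)
qed

text \<open>Inserting \<open>\<bar>x\<bar> = sgn_diag x *v x\<close> splits the error into
  \<open>\<bar>y\<bar> - \<bar>x\<bar>\<close> and \<open>sgn_diag x *v (x - y)\<close>. Both are
  dominated componentwise by \<open>x - y\<close>, which explains the factor 2.\<close>

lemma abs_linearization_error:
  fixes x y :: "real ^ 'n"
  assumes N: "absolute_norm N"
  shows "N (\<bar>y\<bar> - sgn_diag x *v y) \<le> 2 * N (x - y)"
proof -
  have norm: "is_norm N" using N by (simp add: absolute_norm_def)
  have "N (\<bar>y\<bar> - sgn_diag x *v y) = N ((\<bar>y\<bar> - \<bar>x\<bar>) + sgn_diag x *v (x - y))"
    by (simp add: matrix_vector_mult_diff_distrib sgn_diag_mult_self)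
  also have "\<dots> \<le> N (\<bar>y\<bar> - \<bar>x\<bar>) + N (sgn_diag x *v (x - y))"
    by (rule is_norm_triangle[OF norm])
  also have "N (\<bar>y\<bar> - \<bar>x\<bar>) \<le> N (x - y)"
    by (rule absolute_norm_mono[OF N]) (simp add: vec_abs_nth)
  also have "N (sgn_diag x *v (x - y)) \<le> N (x - y)"
    by (rule absolute_norm_mono[OF N]) (auto simp: sgn_diag_mult_nth sgn_real_def)
  finally show ?thesis by simp
qed

section \<open>Residuals and well-definedness\<close>

lemma matrix_inv_mult_vector:
  fixes M :: "real ^ 'n ^ 'n"
  assumes "invertible M"
  shows "matrix_inv M *v (M *v x) = x" "M *v (matrix_inv M *v x) = x"
proof -
  have "M ** matrix_inv M = mat 1 \<and> matrix_inv M ** M = mat 1"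
    using assms unfolding invertible_def matrix_inv_def by (rule someI_ex)
  then show "matrix_inv M *v (M *v x) = x" "M *v (matrix_inv M *v x) = x"
    by (simp_all add: matrix_vector_mul_assoc)
qed

lemma is_norm_le_residual:
  fixes M :: "real ^ 'n ^ 'n"
  assumes "is_norm N" "invertible M"
  shows "N x \<le> mat_norm N (matrix_inv M) * N (M *v x)"
  using mat_norm_bound[OF assms(1), of "matrix_inv M" "M *v x"]
  by (simp add: matrix_inv_mult_vector[OF assms(2)])

text \<open>This identifies \<open>ave_fun A b x\<close> as the residual of \<open>x\<close> itself
  in the linear system of the Newton step at \<open>x\<close>.\<close>

lemma ave_fun_eq: "ave_fun A b x = (A - sgn_diag x) *v x - b"
  by (simp add: ave_fun_def matrix_vector_mult_diff_rdistrib sgn_diag_mult_self)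

text \<open>The exact Newton step has residual zero and so meets every nonnegative
  tolerance.\<close>

lemma newton_well_defined_if_invertible:
  assumes "is_norm N" "0 \<le> \<theta>" "\<And>x. invertible (A - sgn_diag x)"
  shows "newton_well_defined N A b \<theta> x0"
proof -
  have "newton_step N A b \<theta> x (matrix_inv (A - sgn_diag x) *v b)" for x
    using assms by (simp add: newton_step_def matrix_inv_mult_vector is_norm_zero is_norm_nonneg)
  then show ?thesis unfolding newton_well_defined_def by blast
qed

section \<open>Unique solvability of the equation\<close>

lemma ave_solution_unique:
  fixes A :: "real ^ 'n ^ 'n"
  assumes N: "absolute_norm N"
    and inv: "invertible (A - sgn_diag x)"
    and small: "mat_norm N (matrix_inv (A - sgn_diag x)) < 1 / 2"
    and x: "A *v x - \<bar>x\<bar> = b" and y: "A *v y - \<bar>y\<bar> = b"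
  shows "x = y"
proof (rule ccontr)
  assume "x \<noteq> y"
  have norm: "is_norm N" using N by (simp add: absolute_norm_def)
  let ?m = "mat_norm N (matrix_inv (A - sgn_diag x))"
  have pos: "0 < N (x - y)" using \<open>x \<noteq> y\<close> by (intro is_norm_pos[OF norm]) simp
  have eq: "A *v x = b + \<bar>x\<bar>" "A *v y = b + \<bar>y\<bar>" using x y by (auto simp: algebra_simps)
  \<comment> \<open>Subtracting the two equations leaves only the linearisation error at
    \<open>x\<close>; its bound then yields \<open>N (x - y) < N (x - y)\<close>.\<close>
  have "(A - sgn_diag x) *v (x - y) = - (\<bar>y\<bar> - sgn_diag x *v y)"
    by (simp add: matrix_vector_mult_diff_rdistrib matrix_vector_mult_diff_distrib
        sgn_diag_mult_self eq)
  then have "N (x - y) \<le> ?m * N (\<bar>y\<bar> - sgn_diag x *v y)"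
    using is_norm_le_residual[OF norm inv, of "x - y"] is_norm_minus[OF norm] by metis
  also have "\<dots> \<le> ?m * (2 * N (x - y))"
    by (intro mult_left_mono abs_linearization_error[OF N] mat_norm_nonneg[OF norm])
  also have "\<dots> < N (x - y)" using small pos by simp
  finally show False by simp
qed

lemma ave_solution_exists:
  fixes A :: "real ^ 'n ^ 'n"
  assumes N: "absolute_norm N"
    and inv: "\<And>x. invertible (A - sgn_diag x)"
    and small: "\<And>x. mat_norm N (matrix_inv (A - sgn_diag x)) < 1 / 2"
  shows "\<exists>x. A *v x - \<bar>x\<bar> = b"
proof -
  have norm: "is_norm N" using N by (simp add: absolute_norm_def)
  define G where "G x = matrix_inv (A - sgn_diag x) *v b" for x
  have G: "(A - sgn_diag x) *v G x = b" for x
    by (simp add: G_def matrix_inv_mult_vector[OF inv])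
  have decr: "N (G (G x) - G x) < N (G x - x)" if "G x \<noteq> x" for x
  proof -
    let ?y = "G x"
    let ?m = "mat_norm N (matrix_inv (A - sgn_diag ?y))"
    have pos: "0 < N (?y - x)" using that by (intro is_norm_pos[OF norm]) simp
    \<comment> \<open>Both \<open>(A - sgn_diag ?y) *v G ?y\<close> and
      \<open>(A - sgn_diag x) *v ?y\<close> equal \<open>b\<close>, so the terms in \<open>A\<close>
      cancel.\<close>
    have "(A - sgn_diag ?y) *v (G ?y - ?y) = \<bar>?y\<bar> - sgn_diag x *v ?y"
      using G[of x] G[of ?y]
      by (simp add: matrix_vector_mult_diff_rdistrib matrix_vector_mult_diff_distrib
          sgn_diag_mult_self algebra_simps)
    then have "N (G ?y - ?y) \<le> ?m * N (\<bar>?y\<bar> - sgn_diag x *v ?y)"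
      using is_norm_le_residual[OF norm inv, of "G ?y - ?y" ?y] by simp
    also have "\<dots> \<le> ?m * (2 * N (x - ?y))"
      by (intro mult_left_mono abs_linearization_error[OF N] mat_norm_nonneg[OF norm])
    also have "\<dots> < N (?y - x)"
      using small[of ?y] pos by (simp add: is_norm_diff_commute[OF norm, of x])
    finally show ?thesis .
  qed
  have "range G = (\<lambda>D. matrix_inv (A - D) *v b) ` range sgn_diag"
    by (auto simp: G_def)
  then have fin: "finite (range G)" using finite_imageI[OF finite_range_sgn_diag] by metis
  let ?x = "arg_min_on (\<lambda>x. N (G x - x)) (range G)"
  have min: "N (G ?x - ?x) \<le> N (G y - y)" if "y \<in> range G" for y
    using arg_min_least[OF fin _ that, of "\<lambda>x. N (G x - x)"] that by blast
  \<comment> \<open>Otherwise \<open>G ?x\<close>, again a point of the range, would have a strictly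
    smaller displacement than the minimiser.\<close>
  have "G ?x = ?x"
    using decr[of ?x] min[of "G ?x"] by force
  then have "(A - sgn_diag ?x) *v ?x = b" using G[of ?x] by simp
  then have "A *v ?x - \<bar>?x\<bar> = b"
    by (simp add: matrix_vector_mult_diff_rdistrib sgn_diag_mult_self)
  then show ?thesis ..
qed

section \<open>Error estimate and linear convergence\<close>

lemma newton_step_error:
  fixes A :: "real ^ 'n ^ 'n"
  assumes N: "absolute_norm N" and theta: "0 \<le> \<theta>"
    and inv: "invertible (A - sgn_diag x)"
    and sol: "A *v xs - \<bar>xs\<bar> = b"
    and step: "newton_step N A b \<theta> x y"
  shows "N (y - xs) \<le> mat_norm N (matrix_inv (A - sgn_diag x)) *
    (\<theta> * (mat_norm N (A - sgn_diag x) + 2) + 2) * N (x - xs)"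
proof -
  have norm: "is_norm N" using N by (simp add: absolute_norm_def)
  let ?M = "A - sgn_diag x" and ?e = "\<bar>xs\<bar> - sgn_diag x *v xs"
  have Mxs: "?M *v xs = b + ?e"
    using sol by (auto simp: matrix_vector_mult_diff_rdistrib)
  have err: "N ?e \<le> 2 * N (x - xs)" by (rule abs_linearization_error[OF N])
  \<comment> \<open>Relative to the solution, \<open>ave_fun A b x\<close> is a linear term plus
    \<open>?e\<close>; this gives the factor \<open>mat_norm N ?M + 2\<close> next to
    \<open>\<theta>\<close>.\<close>
  have "ave_fun A b x = ?M *v (x - xs) + ?e"
    by (simp add: ave_fun_eq matrix_vector_mult_diff_distrib Mxs)
  then have "N (ave_fun A b x) \<le> N (?M *v (x - xs)) + N ?e"
    using is_norm_triangle[OF norm] by metis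
  also have "\<dots> \<le> (mat_norm N ?M + 2) * N (x - xs)"
    using mat_norm_bound[OF norm, of ?M "x - xs"] err by (simp add: algebra_simps)
  finally have F: "\<theta> * N (ave_fun A b x) \<le> \<theta> * ((mat_norm N ?M + 2) * N (x - xs))"
    using theta by (rule mult_left_mono)
  \<comment> \<open>The first term is the residual controlled by the tolerance; \<open>?e\<close>
    contributes the summand 2 outside \<open>\<theta>\<close>.\<close>
  have "?M *v (y - xs) = (?M *v y - b) - ?e"
    by (simp add: matrix_vector_mult_diff_distrib Mxs)
  then have "N (?M *v (y - xs)) \<le> N (?M *v y - b) + N ?e"
    using is_norm_triangle_diff[OF norm] by metis
  also have "\<dots> \<le> (\<theta> * (mat_norm N ?M + 2) + 2) * N (x - xs)"
    using step F err by (simp add: newton_step_def algebra_simps)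
  finally have res: "N (?M *v (y - xs)) \<le> (\<theta> * (mat_norm N ?M + 2) + 2) * N (x - xs)" .
  have "N (y - xs) \<le> mat_norm N (matrix_inv ?M) * N (?M *v (y - xs))"
    by (rule is_norm_le_residual[OF norm inv])
  also have "\<dots> \<le> mat_norm N (matrix_inv ?M) * ((\<theta> * (mat_norm N ?M + 2) + 2) * N (x - xs))"
    using res by (rule mult_left_mono) (rule mat_norm_nonneg[OF norm])
  finally show ?thesis by (simp add: mult.assoc)
qed

text \<open>For \<open>m = 0\<close> the assumed bound on \<open>\<theta>\<close> is \<open>1 / 0 = 0\<close>, which contradicts \<open>0 \<le> \<theta>\<close>.\<close>

lemma contraction_factor_less_1:
  fixes \<theta> m K :: real
  assumes "0 \<le> \<theta>" "0 \<le> m" "0 \<le> K" "\<theta> < (1 - 2 * m) / (m * (K + 2))"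
  shows "m * (\<theta> * (K + 2) + 2) < 1"
proof -
  have "m \<noteq> 0" using assms(1,4) by auto
  then have "0 < m * (K + 2)" using assms(2,3) by simp
  then have "\<theta> * (m * (K + 2)) < 1 - 2 * m" using assms(4) by (simp add: pos_less_divide_eq)
  then show ?thesis by (simp add: algebra_simps)
qed

theorem theorem1:
  fixes N :: "real ^ 'n \<Rightarrow> real" and A :: "real ^ 'n ^ 'n" and b :: "real ^ 'n" and \<theta> :: real
  assumes norm: "is_norm N"
    and theta: "0 \<le> \<theta>" "\<theta> < 1"
    and inv: "\<And>x. invertible (A - sgn_diag x)"
  shows "(\<forall>x0. newton_well_defined N A b \<theta> x0) \<and>
    (absolute_norm N \<longrightarrow>
     (\<forall>x. mat_norm N (matrix_inv (A - sgn_diag x)) < 1 / 2) \<longrightarrow>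
       (\<exists>!x. A *v x - \<bar>x\<bar> = b) \<and>
       ((\<forall>x. \<theta> < (1 - 2 * mat_norm N (matrix_inv (A - sgn_diag x))) /
               (mat_norm N (matrix_inv (A - sgn_diag x)) * (mat_norm N (A - sgn_diag x) + 2))) \<longrightarrow>
         (\<exists>xs. A *v xs - \<bar>xs\<bar> = b \<and> (\<forall>y. A *v y - \<bar>y\<bar> = b \<longrightarrow> y = xs) \<and>
           (\<forall>X. newton_sequence N A b \<theta> X \<longrightarrow>
              Q_linearly_converges N X xs \<and>
              (\<forall>k. N (X (Suc k) - xs) \<le>
                 mat_norm N (matrix_inv (A - sgn_diag (X k))) *
                 (\<theta> * (mat_norm N (A - sgn_diag (X k)) + 2) + 2) * N (X k - xs))))))"
proof (intro conjI impI allI)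
  show "newton_well_defined N A b \<theta> x0" for x0
    by (rule newton_well_defined_if_invertible[OF norm theta(1) inv])
next
  assume N: "absolute_norm N"
    and small: "\<forall>x. mat_norm N (matrix_inv (A - sgn_diag x)) < 1 / 2"
  obtain xs where xs: "A *v xs - \<bar>xs\<bar> = b"
    using ave_solution_exists[OF N inv] small by blast
  have uniq: "y = xs" if "A *v y - \<bar>y\<bar> = b" for y
    using ave_solution_unique[OF N inv _ that xs] small by blast
  show "\<exists>!x. A *v x - \<bar>x\<bar> = b" using xs uniq by blast
  \<comment> \<open>The factor is a function of the sign matrix, so only finitely many values occur
    along any sequence.\<close>
  define q where "q D = mat_norm N (matrix_inv (A - D)) * (\<theta> * (mat_norm N (A - D) + 2) + 2)" for D
  assume bound: "\<forall>x. \<theta> < (1 - 2 * mat_norm N (matrix_inv (A - sgn_diag x))) /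
    (mat_norm N (matrix_inv (A - sgn_diag x)) * (mat_norm N (A - sgn_diag x) + 2))"
  have q_less: "q (sgn_diag x) < 1" for x
    unfolding q_def using bound
    by (intro contraction_factor_less_1 theta(1) mat_norm_nonneg[OF norm]) blast
  have q_nonneg: "0 \<le> q D" for D
    using theta(1) by (simp add: q_def mat_norm_nonneg[OF norm])
  define c where "c = Max (q ` range sgn_diag)"
  have fin: "finite (q ` range sgn_diag)" by (intro finite_imageI finite_range_sgn_diag)
  \<comment> \<open>The maximum of the finite set is attained, so the pointwise strict bound passes
    to the uniform constant \<open>c\<close>.\<close>
  have c_less: "c < 1" using fin q_less by (auto simp: c_def)
  have q_le: "q (sgn_diag x) \<le> c" for x
    unfolding c_def using fin by (intro Max_ge) auto
  have c_nonneg: "0 \<le> c" using q_nonneg q_le order_trans by blast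
  have "Q_linearly_converges N X xs \<and> (\<forall>k. N (X (Suc k) - xs) \<le> q (sgn_diag (X k)) * N (X k - xs))"
    if "newton_sequence N A b \<theta> X" for X
  proof -
    have est: "N (X (Suc k) - xs) \<le> q (sgn_diag (X k)) * N (X k - xs)" for k
      unfolding q_def using that
      by (intro newton_step_error[OF N theta(1) inv xs]) (simp add: newton_sequence_def)
    have "N (X (Suc k) - xs) \<le> c * N (X k - xs)" for k
      using est[of k] mult_right_mono[OF q_le is_norm_nonneg[OF norm]] by (rule order_trans)
    with est show ?thesis using Q_linearly_convergesI[OF norm c_nonneg c_less] by blast
  qed
  then show "\<exists>xs. A *v xs - \<bar>xs\<bar> = b \<and> (\<forall>y. A *v y - \<bar>y\<bar> = b \<longrightarrow> y = xs) \<and>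
      (\<forall>X. newton_sequence N A b \<theta> X \<longrightarrow>
        Q_linearly_converges N X xs \<and>
        (\<forall>k. N (X (Suc k) - xs) \<le>
          mat_norm N (matrix_inv (A - sgn_diag (X k))) *
          (\<theta> * (mat_norm N (A - sgn_diag (X k)) + 2) + 2) * N (X k - xs)))"
    using xs uniq unfolding q_def by blast
qed

end
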